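(* Let $\mathrm{G}$ be an arbitrary $[1,h]_{\mathbb{N}}$-marked digraph with $h>0$. Then $\mathrm{N}^\ast_{\mathrm{G}}=|\bar{M}_{\mathrm{G}}|+|S^2_{\mathrm{G}}|$.
   Context: A $[1,h]_{\mathbb{N}}$-marked digraph $\mathrm{G}=(\mathrm{V},\mathrm{E})$ is a finite digraph with $\mathrm{V}=\{v_1,\dots,v_n\}$ (self-loops allowed) in which $v_1,\dots,v_h$ are marked as directly observable; the other vertices are called simple. A cycle is a closed walk along directed edges without repeated vertices other than start = end (a self-loop is a cycle). A simple vertex $v$ satisfies Property $P_1$ if there is a vertex $v'$ whose unique in-neighbor is $v$; $\mathrm{G}$ satisfies $P_1$ if all its simple vertices do. A cycle $C$ consisting entirely of simple vertices satisfies Property $P_2$ if there is a vertex $v\notin C$ whose unique in-neighbor is some vertex of $C$; $\mathrm{G}$ satisfies $P_2$ if all its cycles consisting entirely of simple vertices do. Here a marked digraph is called a structurally observable graph (SOG) if it satisfies both $P_1$ and $P_2$. To control a vertex means to replace its set of in-neighbors by an arbitrary set of vertices (the marking is unchanged). $\mathrm{N}^\ast_{\mathrm{G}}$ is the minimum cardinality of a set $\Lambda\subseteq\mathrm{V}$ such that by controlling only the vertices of $\Lambda$ one can turn $\mathrm{G}$ into an SOG. $\bar{M}_{\mathrm{G}}$ is the set of simple vertices of $\mathrm{G}$ that do not satisfy Property $P_1$. An OP-CC (observed-path-compatible cycle) of $\mathrm{G}$ is a cycle through vertices $v_{i_1},\dots,v_{i_s}$ such that $v_{i_j}$ is the only in-neighbor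 of $v_{i_{j+1}}$ for $1\le j\le s-1$ and $v_{i_s}$ is the only in-neighbor of $v_{i_1}$ (cycles are identified up to rotation). $S^2_{\mathrm{G}}$ is the set of OP-CCs of $\mathrm{G}$ that consist entirely of simple vertices and do not satisfy Property $P_2$. *)

theory Defs
  imports "Graph_Theory.Pair_Digraph"
begin

(* The vertices are v 1, ..., v n; the marked ones are v 1, ..., v h. *)
locale marked_digraph = pair_fin_digraph G
  for G :: "'a pair_pre_digraph" +
  fixes v :: "nat \<Rightarrow> 'a" and n h :: nat
  assumes enum: "bij_betw v {1..n} (pverts G)"
    and h_le_n: "h \<le> n"

definition marked :: "(nat \<Rightarrow> 'a) \<Rightarrow> nat \<Rightarrow> 'a set" where
  "marked v h = v ` {1..h}"

text \<open>In what follows, \<open>M\<close> is the set of marked vertices.\<close>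

definition simple_verts :: "'a pair_pre_digraph \<Rightarrow> 'a set \<Rightarrow> 'a set" where
  "simple_verts G M = pverts G - M"

definition in_nbrs :: "'a pair_pre_digraph \<Rightarrow> 'a \<Rightarrow> 'a set" where
  "in_nbrs G w = {u. (u, w) \<in> parcs G}"

text \<open>A cycle is, as in the library, a list of arcs. Every vertex of a closed walk with at least
  one arc is the tail of one of its arcs. The library predicate admits cycles of length 1,
  i.e. self-loops.\<close>

definition cycle_verts :: "('a \<times> 'a) awalk \<Rightarrow> 'a set" where
  "cycle_verts p = fst ` set p"

definition simple_cycle :: "'a pair_pre_digraph \<Rightarrow> 'a set \<Rightarrow> ('a \<times> 'a) awalk \<Rightarrow> bool" where
  "simple_cycle G M p \<longleftrightarrow>
     pre_digraph.cycle (with_proj G) p \<and> cycle_verts p \<subseteq> simple_verts G M"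

definition vertex_P1 :: "'a pair_pre_digraph \<Rightarrow> 'a \<Rightarrow> bool" where
  "vertex_P1 G u \<longleftrightarrow> (\<exists>w\<in>pverts G. in_nbrs G w = {u})"

definition graph_P1 :: "'a pair_pre_digraph \<Rightarrow> 'a set \<Rightarrow> bool" where
  "graph_P1 G M \<longleftrightarrow> (\<forall>u\<in>simple_verts G M. vertex_P1 G u)"

definition cycle_P2 :: "'a pair_pre_digraph \<Rightarrow> ('a \<times> 'a) awalk \<Rightarrow> bool" where
  "cycle_P2 G p \<longleftrightarrow>
     (\<exists>w\<in>pverts G. w \<notin> cycle_verts p \<and> (\<exists>u\<in>cycle_verts p. in_nbrs G w = {u}))"

definition graph_P2 :: "'a pair_pre_digraph \<Rightarrow> 'a set \<Rightarrow> bool" where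
  "graph_P2 G M \<longleftrightarrow> (\<forall>p. simple_cycle G M p \<longrightarrow> cycle_P2 G p)"

definition SOG :: "'a pair_pre_digraph \<Rightarrow> 'a set \<Rightarrow> bool" where
  "SOG G M \<longleftrightarrow> graph_P1 G M \<and> graph_P2 G M"

text \<open>\<open>H\<close> arises from \<open>G\<close> by controlling only vertices of \<open>L\<close>.\<close>

definition controlled :: "'a pair_pre_digraph \<Rightarrow> 'a set \<Rightarrow> 'a pair_pre_digraph \<Rightarrow> bool" where
  "controlled G L H \<longleftrightarrow>
     pair_fin_digraph H \<and> pverts H = pverts G \<and>
     (\<forall>w\<in>pverts G - L. in_nbrs H w = in_nbrs G w)"

definition N_star :: "'a pair_pre_digraph \<Rightarrow> 'a set \<Rightarrow> nat" where
  "N_star G M =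
     (LEAST k. \<exists>L\<subseteq>pverts G. card L = k \<and> (\<exists>H. controlled G L H \<and> SOG H M))"

definition M_bar :: "'a pair_pre_digraph \<Rightarrow> 'a set \<Rightarrow> 'a set" where
  "M_bar G M = {u \<in> simple_verts G M. \<not> vertex_P1 G u}"

definition OP_CC :: "'a pair_pre_digraph \<Rightarrow> ('a \<times> 'a) awalk \<Rightarrow> bool" where
  "OP_CC G p \<longleftrightarrow>
     pre_digraph.cycle (with_proj G) p \<and> (\<forall>(u, w)\<in>set p. in_nbrs G w = {u})"

definition rotation :: "('a list \<times> 'a list) set" where
  "rotation = {(p, q). \<exists>k. q = rotate k p}"

text \<open>Cycles are identified up to rotation by passing to the quotient.\<close>

definition S2 :: "'a pair_pre_digraph \<Rightarrow> 'a set \<Rightarrow> ('a \<times> 'a) awalk set set" where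
  "S2 G M = {p. OP_CC G p \<and> simple_cycle G M p \<and> \<not> cycle_P2 G p} // rotation"

end

theory Submission
  imports Defs
begin

text \<open>Call an arc \<open>(u, w)\<close> private if \<open>u\<close> is the only in-neighbor of \<open>w\<close>; private arcs never share
  a head. Lower bound: after control, every vertex of \<open>M_bar\<close> and every cycle of \<open>S2\<close> must have a new
  private arc leaving it, hence one whose head is controlled. The sets concerned are pairwise disjoint,
  so these heads are distinct. Upper bound: select one private arc at each simple vertex that has one,
  avoiding arcs whose head lies on a cycle of private arcs whenever possible. The cycles that survive
  are exactly those of \<open>S2\<close>; dropping one arc of each leaves a system of disjoint paths that misses
  at most \<open>|M_bar| + |S2|\<close> simple vertices. Give each of these a successor among the starting points
  of the paths, without closing a cycle, by controlling that starting point. An acyclic system of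
  private arcs that leaves every simple vertex forces both \<open>P1\<close> and \<open>P2\<close>.\<close>

section \<open>Cycles as lists of arcs\<close>

lemma pcas_Cons_iff_heads:
  "pcas u (e # es) v \<longleftrightarrow> fst e = u \<and> map snd (e # es) = map fst es @ [v]"
  by (induction es arbitrary: u e) auto

text \<open>Only the inclusion in \<open>parcs G\<close> refers to the graph here, so a cycle
  carries over to any digraph that contains its arcs.\<close>

lemma (in pair_wf_digraph) cycle_iff_heads_rotate1:
  "cycle p \<longleftrightarrow> p \<noteq> [] \<and> set p \<subseteq> parcs G \<and> map snd p = rotate1 (map fst p) \<and> distinct (map fst p)"
proof (cases p)
  case Nil
  then show ?thesis by (simp add: cycle_def)
next
  case (Cons e es)
  \<comment> \<open>The library's \<open>cycle\<close> asks for distinctness of this tail, that is,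
    of the heads.\<close>
  have tl_verts: "tl (pawalk_verts u p) = map snd p" if "pcas u p u" for u
    using awalk_verts_conv'[of u p u] that Cons by simp
  have pcas: "pcas u p u \<longleftrightarrow> fst e = u \<and> map snd p = rotate1 (map fst p)" for u
    unfolding Cons pcas_Cons_iff_heads by auto
  have ne: "p \<noteq> []" using Cons by simp
  have "cycle p \<longleftrightarrow>
      (\<exists>u. u \<in> pverts G \<and> set p \<subseteq> parcs G \<and> pcas u p u \<and> distinct (map snd p))"
    unfolding cycle_def awalk_def conj_assoc using ne by (simp only: tl_verts simp_thms cong: conj_cong)
  moreover have "fst e \<in> pverts G" if "set p \<subseteq> parcs G"
    using that Cons by (simp add: arc_fst_in_verts)
  ultimately have "cycle p \<longleftrightarrow>
      set p \<subseteq> parcs G \<and> map snd p = rotate1 (map fst p) \<and> distinct (map snd p)"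
    unfolding pcas by blast
  moreover have "distinct (map snd p) \<longleftrightarrow> distinct (map fst p)"
    if "map snd p = rotate1 (map fst p)"
    by (simp only: that distinct1_rotate)
  ultimately show ?thesis using ne by blast
qed

lemma (in pair_wf_digraph) cycle_heads:
  assumes "cycle p"
  shows "snd ` set p = cycle_verts p"
proof -
  have "set (map snd p) = set (map fst p)"
    using assms by (simp only: cycle_iff_heads_rotate1 set_rotate1)
  then show ?thesis by (simp add: cycle_verts_def)
qed

text \<open>The walk is split at an arc leaving \<open>x\<close>; that arc belongs to the second
  piece, which is therefore nonempty.\<close>

lemma pcas_trancl:
  assumes "pcas u p v" and "x \<in> fst ` set p"
  shows "(u, x) \<in> (set p)\<^sup>*" and "(x, v) \<in> (set p)\<^sup>+"
proof -
  have path: "(u, v) \<in> (set p)\<^sup>*" if "pcas u p v" for u p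
    using that
  proof (induction p arbitrary: u)
    case (Cons e es)
    then have "(snd e, v) \<in> (set (e # es))\<^sup>*" by (auto intro: subsetD[OF rtrancl_mono])
    then show ?case using Cons.prems by (cases e) (auto intro: converse_rtrancl_into_rtrancl)
  qed simp
  have "(u, x) \<in> (set p)\<^sup>* \<and> (x, v) \<in> (set p)\<^sup>+"
    using assms
  proof (induction p arbitrary: u)
    case (Cons e es)
    have mono: "(set es)\<^sup>* \<subseteq> (set (e # es))\<^sup>*" "(set es)\<^sup>+ \<subseteq> (set (e # es))\<^sup>+"
      by (auto intro: trancl_mono subsetD[OF rtrancl_mono])
    have e: "(u, snd e) \<in> set (e # es)" using Cons.prems(1) by (cases e) auto
    show ?case
    proof (cases "x \<in> fst ` set es")
      case True
      then have "(snd e, x) \<in> (set es)\<^sup>*" "(x, v) \<in> (set es)\<^sup>+"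
        using Cons.IH Cons.prems(1) by auto
      then show ?thesis using mono e by (blast intro: converse_rtrancl_into_rtrancl)
    next
      case False
      then have "x = u" using Cons.prems by auto
      moreover have "(snd e, v) \<in> (set (e # es))\<^sup>*" using path[of "snd e" es] Cons.prems(1) mono by auto
      ultimately show ?thesis using e by (blast intro: rtrancl_into_trancl2)
    qed
  qed simp
  then show "(u, x) \<in> (set p)\<^sup>*" "(x, v) \<in> (set p)\<^sup>+" by auto
qed

text \<open>Go from \<open>x\<close> on to the base point of the closed walk, using at least one
  arc, and from there to \<open>y\<close>.\<close>

lemma (in pair_wf_digraph) cycle_trancl:
  assumes "cycle p" and "x \<in> cycle_verts p" and "y \<in> cycle_verts p"
  shows "(x, y) \<in> (set p)\<^sup>+"
  using assms pcas_trancl unfolding cycle_def awalk_def cycle_verts_def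
  by (metis trancl_rtrancl_trancl)

text \<open>Taking \<open>F\<close> itself as the arc set of a digraph keeps the cycle extracted
  from a closed walk inside \<open>F\<close>.\<close>

lemma (in pair_wf_digraph) cycle_if_not_acyclic:
  assumes "F \<subseteq> parcs G" and "\<not> acyclic F"
  obtains p where "cycle p" and "set p \<subseteq> F"
proof -
  define H where "H = \<lparr>pverts = pverts G, parcs = F\<rparr>"
  interpret H: pair_wf_digraph H
    by unfold_locales (auto simp: H_def dest: arc_fst_in_verts[OF subsetD[OF assms(1)]]
        arc_snd_in_verts[OF subsetD[OF assms(1)]])
  obtain x where "(x, x) \<in> F\<^sup>+" using assms(2) by (auto simp: acyclic_def)
  then have "\<exists>p. H.awalk x p x \<and> p \<noteq> []"
    using H.reachable1_awalk[of x x] by (simp add: H_def)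
  then obtain p where "H.closed_w p" by (auto simp: H.closed_w_def)
  then obtain q where "H.cycle q" using H.closed_w_imp_cycle by blast
  then show thesis
    using that assms(1) unfolding H.cycle_iff_heads_rotate1 cycle_iff_heads_rotate1
    by (simp add: H_def) blast
qed

section \<open>Cycles up to rotation\<close>

lemma equiv_rotation: "equiv UNIV (rotation :: ('a list \<times> 'a list) set)" (is "equiv _ ?r")
proof (rule equivI)
  show "refl ?r" by (auto simp: refl_on_def rotation_def intro: exI[of _ 0])
  show "sym ?r"
  proof (rule symI)
    fix p q :: "'a list" assume "(p, q) \<in> ?r"
    \<comment> \<open>With \<open>k\<close> reduced modulo the length, the complementary rotation is
      not cut off by subtraction on naturals.\<close>
    then obtain k where q: "q = rotate (k mod length p) p"
      by (auto simp: rotation_def rotate_conv_mod[symmetric])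
    have "rotate (length p - k mod length p) q = p"
      unfolding q rotate_rotate
      by (cases "p = []") (simp_all add: mod_le_divisor)
    then show "(q, p) \<in> ?r" unfolding rotation_def by (auto dest: sym)
  qed
  show "trans ?r" by (auto simp: trans_def rotation_def rotate_rotate)
qed auto

text \<open>Distinct tails turn the arc set into a successor function. Both lists trace its orbit,
  so they agree once \<open>p\<close> is shifted to the position \<open>k\<close> of the first arc
  of \<open>q\<close>.\<close>

lemma rotation_if_same_arcs:
  assumes p: "map snd p = rotate1 (map fst p)" and q: "map snd q = rotate1 (map fst q)"
    and set_eq: "set p = set q" and dist: "distinct (map fst p)" "distinct (map fst q)"
    and ne: "p \<noteq> []"
  shows "(p, q) \<in> rotation"
proof -
  have len: "length p = length q"
    using set_eq dist by (metis distinct_card distinct_map)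
  have succ: "snd (r ! i) = fst (r ! (Suc i mod length r))"
    if "map snd r = rotate1 (map fst r)" "i < length r" for r :: "('a \<times> 'a) list" and i
  proof -
    have "Suc i mod length r < length r" using that(2) by (auto intro: mod_less_divisor)
    then show ?thesis
      using arg_cong[OF that(1), of "\<lambda>xs. xs ! i"] that(2) by (simp add: nth_rotate1)
  qed
  have arc_eq: "a = b" if "a \<in> set q" "b \<in> set q" "fst a = fst b" for a b
    using that dist(2) by (auto simp: distinct_map inj_on_def)
  have "q \<noteq> []" using ne len by auto
  then have "q ! 0 \<in> set p" using set_eq by simp
  then obtain k where k: "k < length p" "p ! k = q ! 0" by (auto simp: in_set_conv_nth)
  have "q ! i = p ! ((k + i) mod length p)" if "i < length q" for i
    using that
  proof (induction i)
    case 0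
    then show ?case using k by simp
  next
    case (Suc i)
    let ?j = "(k + i) mod length p"
    have j: "?j < length p" using ne by simp
    have "fst (q ! Suc i) = snd (q ! i)" using succ[OF q, of i] Suc.prems by simp
    also have "\<dots> = snd (p ! ?j)" using Suc by simp
    also have "\<dots> = fst (p ! ((k + Suc i) mod length p))"
      using succ[OF p j] by (simp add: mod_Suc_eq)
    finally show ?case
    proof (rule arc_eq[rotated 2])
      show "q ! Suc i \<in> set q" using Suc.prems by (rule nth_mem)
      have "(k + Suc i) mod length p < length p" using ne by simp
      then show "p ! ((k + Suc i) mod length p) \<in> set q"
        unfolding set_eq[symmetric] by (rule nth_mem)
    qed
  qed
  then have "q = rotate k p"
    by (intro nth_equalityI) (simp_all add: len nth_rotate)
  then show ?thesis by (auto simp: rotation_def)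
qed

section \<open>OP-CCs and the classes in \<open>S2\<close>\<close>

text \<open>On an OP-CC the predecessor of a vertex is its only in-neighbor. Hence following
  \<open>p\<close> backwards from a common vertex never leaves \<open>q\<close>.\<close>

lemma (in pair_wf_digraph) OP_CC_set_subset:
  assumes "OP_CC G p" and "OP_CC G q" and "cycle_verts p \<inter> cycle_verts q \<noteq> {}"
  shows "set p \<subseteq> set q"
proof -
  have cyc: "cycle p" "cycle q" using assms by (auto simp: OP_CC_def)
  have nbr: "in_nbrs G w = {u}" if "(u, w) \<in> set p \<or> (u, w) \<in> set q" for u w
    using that assms(1,2) unfolding OP_CC_def by auto
  have pred_in: "u \<in> cycle_verts q" "(u, w) \<in> set q"
    if w: "w \<in> cycle_verts q" and uw: "(u, w) \<in> set p" for u w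
  proof -
    obtain x where x: "(x, w) \<in> set q"
      using w cycle_heads[OF cyc(2)] by force
    then have "x = u" using nbr[of x w] nbr[of u w] uw by auto
    with x show "(u, w) \<in> set q" "u \<in> cycle_verts q" by (force simp: cycle_verts_def)+
  qed
  obtain z where z: "z \<in> cycle_verts p" "z \<in> cycle_verts q" using assms(3) by auto
  have "cycle_verts p \<subseteq> cycle_verts q"
  proof
    fix x assume "x \<in> cycle_verts p"
    then have "(x, z) \<in> (set p)\<^sup>*"
      using cycle_trancl[OF cyc(1)] z(1) by (simp add: trancl_into_rtrancl)
    then show "x \<in> cycle_verts q"
      by (induction rule: converse_rtrancl_induct) (use z(2) pred_in(1) in auto)
  qed
  then show ?thesis
    using pred_in(2) cycle_heads[OF cyc(1)] by (auto simp: image_iff) (metis image_eqI snd_conv subsetD)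
qed

lemma (in pair_wf_digraph) OP_CC_rotation:
  assumes "OP_CC G p" and "OP_CC G q" and "cycle_verts p \<inter> cycle_verts q \<noteq> {}"
  shows "(p, q) \<in> rotation"
proof (rule rotation_if_same_arcs)
  show "set p = set q"
    using OP_CC_set_subset[of p q] OP_CC_set_subset[of q p] assms by (auto simp: Int_commute)
qed (use assms in \<open>auto simp: OP_CC_def cycle_iff_heads_rotate1\<close>)

text \<open>Rotations share their vertices, so the union avoids choosing a representative.\<close>

definition class_verts :: "('a \<times> 'a) awalk set \<Rightarrow> 'a set" where
  "class_verts c = \<Union> (cycle_verts ` c)"

lemma class_verts_rotation: "class_verts (rotation `` {p}) = cycle_verts p"
proof -
  have "rotation `` {p} = range (\<lambda>k. rotate k p)" by (auto simp: rotation_def)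
  then show ?thesis by (simp add: class_verts_def cycle_verts_def)
qed

lemma S2_cases:
  assumes "c \<in> S2 G M"
  obtains p where "c = rotation `` {p}" "class_verts c = cycle_verts p"
    "OP_CC G p" "simple_cycle G M p" "\<not> cycle_P2 G p"
proof -
  obtain p where "c = rotation `` {p}" "OP_CC G p" "simple_cycle G M p" "\<not> cycle_P2 G p"
    using assms unfolding S2_def by (auto elim!: quotientE)
  then show thesis using that class_verts_rotation by metis
qed

text \<open>Distinct tails make a cycle a list of distinct arcs, and a finite arc set admits only
  finitely many of these.\<close>

lemma (in pair_fin_digraph) finite_S2: "finite (S2 G M)"
proof -
  have "finite {p. set p \<subseteq> parcs G \<and> distinct p}"
    by (rule finite_subset_distinct) (rule pair_finite_arcs)
  then have "finite {p. OP_CC G p \<and> simple_cycle G M p \<and> \<not> cycle_P2 G p}"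
    by (rule rev_finite_subset)
      (auto simp: OP_CC_def cycle_iff_heads_rotate1 distinct_map)
  then show ?thesis by (auto simp: S2_def quotient_def)
qed

lemma (in pair_wf_digraph) S2_disjoint:
  assumes "c \<in> S2 G M" and "d \<in> S2 G M" and "x \<in> class_verts c" and "x \<in> class_verts d"
  shows "c = d"
proof -
  obtain p where p: "c = rotation `` {p}" "class_verts c = cycle_verts p" "OP_CC G p"
    using assms(1) by (rule S2_cases)
  obtain q where q: "d = rotation `` {q}" "class_verts d = cycle_verts q" "OP_CC G q"
    using assms(2) by (rule S2_cases)
  have "(p, q) \<in> rotation" using OP_CC_rotation p q assms(3,4) by blast
  then show ?thesis using p(1) q(1) equiv_class_eq[OF equiv_rotation] by metis
qed

lemma (in pair_wf_digraph) OP_CC_arcs_into: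
  assumes "OP_CC G p" and "w \<in> cycle_verts p" and "in_nbrs G w = {u}"
  shows "(u, w) \<in> set p"
proof -
  obtain x where x: "(x, w) \<in> set p"
    using assms(1,2) cycle_heads[of p] by (force simp: OP_CC_def)
  then have "in_nbrs G w = {x}" using assms(1) by (auto simp: OP_CC_def)
  with x assms(3) show ?thesis by simp
qed

section \<open>The lower bound\<close>

lemma card_le_controlled:
  fixes G :: "'a pair_pre_digraph"
  assumes G: "pair_fin_digraph G" and ctrl: "controlled G L H" and sog: "SOG H M"
    and L: "L \<subseteq> pverts G"
  shows "card (M_bar G M) + card (S2 G M) \<le> card L"
proof -
  interpret G: pair_fin_digraph G by fact
  interpret H: pair_fin_digraph H using ctrl by (simp add: controlled_def)
  have verts: "pverts H = pverts G"
    and nbrs: "\<And>w. w \<in> pverts G - L \<Longrightarrow> in_nbrs H w = in_nbrs G w"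
    using ctrl by (auto simp: controlled_def)
  have P1: "\<exists>w\<in>pverts G. in_nbrs H w = {u}" if "u \<in> simple_verts G M" for u
    using sog that verts by (auto simp: SOG_def graph_P1_def vertex_P1_def simple_verts_def)
  \<comment> \<open>\<open>B x\<close> is the set of vertices from which a private arc of
    \<open>H\<close> with controlled head has to start: one vertex for \<open>M_bar\<close>, a whole
    cycle for \<open>S2\<close>.\<close>
  define B where "B = case_sum (\<lambda>u::'a. {u}) class_verts"
  let ?X = "M_bar G M <+> S2 G M"
  have "\<exists>w\<in>L. \<exists>u\<in>B x. in_nbrs H w = {u}" if "x \<in> ?X" for x
    using that
  proof (elim PlusE)
    fix u assume u: "u \<in> M_bar G M" "x = Inl u"
    then have S: "u \<in> simple_verts G M" and notP1: "\<not> vertex_P1 G u" by (auto simp: M_bar_def)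
    obtain w where w: "w \<in> pverts G" "in_nbrs H w = {u}" using P1[OF S] by auto
    have "w \<in> L"
    proof (rule ccontr)
      assume "w \<notin> L"
      then have "in_nbrs G w = {u}" using w nbrs[of w] by simp
      then show False using notP1 w by (auto simp: vertex_P1_def)
    qed
    then show ?thesis using w u by (auto simp: B_def)
  next
    fix c assume c: "c \<in> S2 G M" "x = Inr c"
    obtain p where p: "class_verts c = cycle_verts p" "OP_CC G p" "simple_cycle G M p"
      "\<not> cycle_P2 G p" using c(1) by (rule S2_cases)
    have simple: "cycle_verts p \<subseteq> simple_verts G M" and cyc: "G.cycle p"
      using p(3) by (auto simp: simple_cycle_def)
    have "\<exists>w\<in>L. \<exists>u\<in>cycle_verts p. in_nbrs H w = {u}"
    proof (rule ccontr)
      \<comment> \<open>Then every private arc of \<open>H\<close> starting on \<open>p\<close> is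
        already private in \<open>G\<close>, and it stays on \<open>p\<close> because
        \<open>p\<close> fails \<open>P2\<close> in \<open>G\<close>.\<close>
      assume none: "\<not> ?thesis"
      have inside: "w \<in> cycle_verts p \<and> in_nbrs G w = {u}"
        if "w \<in> pverts G" "u \<in> cycle_verts p" "in_nbrs H w = {u}" for u w
      proof -
        have "w \<notin> L" using none that by auto
        then have "in_nbrs G w = {u}" using nbrs[of w] that by simp
        then show ?thesis using p(4) that by (auto simp: cycle_P2_def)
      qed
      \<comment> \<open>\<open>P1\<close> in \<open>H\<close> provides a private arc at each vertex
        of \<open>p\<close>; by distinctness of tails it is the arc of \<open>p\<close> itself. So
        \<open>p\<close> survives in \<open>H\<close>, where it violates \<open>P2\<close>.\<close>
      have "set p \<subseteq> parcs H"
      proof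
        fix e assume e: "e \<in> set p"
        obtain u y where uy: "e = (u, y)" by (cases e)
        then have u: "u \<in> cycle_verts p" using e by (force simp: cycle_verts_def)
        obtain w where w: "w \<in> pverts G" "in_nbrs H w = {u}" using P1 u simple by blast
        then have "(u, w) \<in> set p"
          using inside[OF w(1) u w(2)] G.OP_CC_arcs_into[OF p(2)] by blast
        moreover have "distinct (map fst p)" using cyc by (simp add: G.cycle_iff_heads_rotate1)
        ultimately have "w = y" using e uy by (metis distinct_map inj_onD fst_conv snd_conv)
        then show "e \<in> parcs H" using w(2) uy by (auto simp: in_nbrs_def)
      qed
      then have "simple_cycle H M p"
        using cyc simple verts unfolding simple_cycle_def H.cycle_iff_heads_rotate1
          G.cycle_iff_heads_rotate1 by (simp add: simple_verts_def)
      then have "cycle_P2 H p" using sog by (auto simp: SOG_def graph_P2_def)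
      then show False using inside verts by (auto simp: cycle_P2_def)
    qed
    then show ?thesis using c p(1) by (simp add: B_def)
  qed
  then obtain g where g: "\<And>x. x \<in> ?X \<Longrightarrow> g x \<in> L \<and> (\<exists>u\<in>B x. in_nbrs H (g x) = {u})"
    by metis
  \<comment> \<open>The arcs of the cycle itself witness \<open>P1\<close>, which separates the
    cycles in \<open>S2\<close> from \<open>M_bar\<close>.\<close>
  have S2_P1: "vertex_P1 G u" if c: "c \<in> S2 G M" and u: "u \<in> class_verts c" for c u
  proof -
    obtain p where p: "class_verts c = cycle_verts p" "OP_CC G p"
      using c by (rule S2_cases)
    then obtain y where y: "(u, y) \<in> set p" using u by (auto simp: cycle_verts_def)
    then have "y \<in> pverts G" "in_nbrs G y = {u}"
      using p(2) by (auto simp: OP_CC_def G.cycle_iff_heads_rotate1 intro: G.wellformed')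
    then show ?thesis by (auto simp: vertex_P1_def)
  qed
  have disj: "x = y" if "x \<in> ?X" "y \<in> ?X" "B x \<inter> B y \<noteq> {}" for x y
    using that by (elim PlusE) (auto simp: B_def M_bar_def dest: S2_P1 G.S2_disjoint)
  have "inj_on g ?X"
  proof (rule inj_onI)
    fix x y assume xy: "x \<in> ?X" "y \<in> ?X" "g x = g y"
    \<comment> \<open>The common head has a single in-neighbor in \<open>H\<close>, and it lies in
      both sets.\<close>
    then have "B x \<inter> B y \<noteq> {}" using g[of x] g[of y] by auto
    then show "x = y" using disj xy by blast
  qed
  moreover have "finite L" using L G.pair_finite_verts by (rule finite_subset)
  ultimately have "card ?X \<le> card L" using g by (intro card_inj_on_le[of g]) auto
  moreover have "finite (M_bar G M)"
    using G.pair_finite_verts by (rule rev_finite_subset) (auto simp: M_bar_def simple_verts_def)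
  ultimately show ?thesis using G.finite_S2 by (simp add: card_Plus)
qed

section \<open>The upper bound: acyclic systems of private arcs\<close>

text \<open>A cycle of simple vertices contains a vertex \<open>u\<close> with no
  \<open>F\<close>-arc back into the cycle, by well-foundedness of the converse. The
  \<open>F\<close>-arc at \<open>u\<close> then witnesses \<open>P2\<close>.\<close>

lemma SOG_if_acyclic:
  assumes H: "pair_fin_digraph H" and dom: "Domain F = simple_verts H M" and "acyclic F"
    and F: "\<And>u w. (u, w) \<in> F \<Longrightarrow> w \<in> pverts H \<and> in_nbrs H w = {u}"
  shows "SOG H M"
proof -
  interpret H: pair_fin_digraph H by fact
  have "F \<subseteq> parcs H" using F by (auto simp: in_nbrs_def)
  then have wf: "wf (F\<inverse>)"
    using \<open>acyclic F\<close> H.pair_finite_arcs by (blast intro: finite_acyclic_wf_converse finite_subset)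
  have "cycle_P2 H p" if p: "simple_cycle H M p" for p
  proof -
    have "cycle_verts p \<noteq> {}"
      using p by (auto simp: simple_cycle_def H.cycle_def cycle_verts_def)
    then obtain u where u: "u \<in> cycle_verts p" "\<And>w. (u, w) \<in> F \<Longrightarrow> w \<notin> cycle_verts p"
      using wfE_min[OF wf] by (metis converseI ex_in_conv)
    then have "u \<in> Domain F" using p dom by (auto simp: simple_cycle_def)
    then obtain w where "(u, w) \<in> F" by blast
    then show ?thesis using u F unfolding cycle_P2_def by blast
  qed
  moreover have "graph_P1 H M"
    using F unfolding graph_P1_def vertex_P1_def dom[symmetric] by auto
  ultimately show ?thesis by (auto simp: SOG_def graph_P2_def)
qed

text \<open>A vertex outside the range of \<open>F\<close> starts a path of \<open>F\<close>, and only one of these paths ends in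
  \<open>u\<close>. Since \<open>S \<noteq> V\<close> leaves two such vertices, one of them can become the successor of \<open>u\<close> without
  closing a cycle.\<close>

lemma extend_path_system:
  assumes "finite V" and "S \<subset> V" and "F \<subseteq> S \<times> V"
    and "single_valued F" and "single_valued (F\<inverse>)" and "acyclic F"
  obtains F' where "F \<subseteq> F'" "F' \<subseteq> S \<times> V" "Domain F' = S"
    "single_valued F'" "single_valued (F'\<inverse>)" "acyclic F'"
  using assms(3-)
proof (induction "card (S - Domain F)" arbitrary: F thesis)
  case 0
  have "finite S" using assms by (auto intro: finite_subset)
  then have "Domain F = S" using 0 by auto
  then show ?case using 0 by blast
next
  case (Suc k)
  obtain u where u: "u \<in> S" "u \<notin> Domain F" using Suc.hyps(2) by (metis Diff_iff card.empty ex_in_conv nat.distinct(1))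
  have "finite S" using assms(1,2) by (auto intro: finite_subset)
  moreover have "finite F"
    using Suc.prems(2) by (rule finite_subset) (simp add: assms(1) \<open>finite S\<close>)
  ultimately have finV: "finite (Range F)" "finite S" "finite (Domain F)" "finite F"
    by (auto intro: finite_Range finite_Domain)
  \<comment> \<open>The two gaps \<open>card (Domain F) < card S\<close> and
    \<open>card S < card V\<close> add up to two vertices outside the range.\<close>
  have "card (Range F) = card F"
  proof -
    have "inj_on snd F" using Suc.prems(4) by (auto simp: inj_on_def single_valued_def)
    then show ?thesis by (metis card_image Range_snd)
  qed
  also have "\<dots> = card (Domain F)"
  proof -
    have "inj_on fst F" using Suc.prems(3) by (auto simp: inj_on_def single_valued_def)
    then show ?thesis by (metis card_image Domain_fst)
  qed
  also have "\<dots> < card S"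
    using u Suc.prems(2) finV by (intro psubset_card_mono) auto
  finally have "card (Range F) + 2 \<le> card V"
    using psubset_card_mono[OF assms(1,2)] by simp
  moreover have "Range F \<subseteq> V" using Suc.prems(2) by auto
  ultimately have "2 \<le> card (V - Range F)"
    using finV by (simp add: card_Diff_subset)
  then obtain T where "T \<subseteq> V - Range F" "card T = 2" by (rule obtain_subset_with_card_n)
  then obtain w1 w2 where w: "w1 \<in> V - Range F" "w2 \<in> V - Range F" "w1 \<noteq> w2"
    by (auto simp: card_2_iff)
  have "\<exists>w\<in>V - Range F. (w, u) \<notin> F\<^sup>*"
  proof (rule ccontr)
    assume "\<not> ?thesis"
    then have "(u, w1) \<in> (F\<inverse>)\<^sup>*" "(u, w2) \<in> (F\<inverse>)\<^sup>*" using w by (auto simp: rtrancl_converse)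
    \<comment> \<open>Backwards from \<open>u\<close> there is only one path, so one of
      \<open>w1\<close>, \<open>w2\<close> would precede the other, although neither has a
      predecessor.\<close>
    then have "(w1, w2) \<in> (F\<inverse>)\<^sup>* \<or> (w2, w1) \<in> (F\<inverse>)\<^sup>*"
      using single_valued_confluent Suc.prems(4) by metis
    then show False using w by (metis DiffD2 RangeI converseD converse_rtranclE)
  qed
  then obtain w where w: "w \<in> V" "w \<notin> Range F" "(w, u) \<notin> F\<^sup>*" by auto
  let ?F = "insert (u, w) F"
  have "insert u (S - Domain ?F) = S - Domain F" using u by auto
  then have "card (S - Domain F) = Suc (card (S - Domain ?F))"
    using card_insert_disjoint[of "S - Domain ?F" u] finV(2) by simp
  then have k: "k = card (S - Domain ?F)" using Suc.hyps(2) by linarith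
  show ?case
  proof (rule Suc.hyps(1)[OF k])
    show "?F \<subseteq> S \<times> V" using u w Suc.prems by auto
    show "single_valued ?F" using u Suc.prems(3) by (auto simp: single_valued_def)
    show "single_valued (?F\<inverse>)" using w Suc.prems(4) by (auto simp: single_valued_def)
    show "acyclic ?F" using w Suc.prems(5) by simp
    show thesis
      if "?F \<subseteq> K" "K \<subseteq> S \<times> V" "Domain K = S" "single_valued K"
        "single_valued (K\<inverse>)" "acyclic K" for K
      using Suc.prems(1)[of K] that by simp
  qed
qed

text \<open>Tails are restricted to simple vertices, so that every cycle of such arcs is an OP-CC
  consisting of simple vertices.\<close>

definition private_arcs :: "'a pair_pre_digraph \<Rightarrow> 'a set \<Rightarrow> 'a rel" where
  "private_arcs G M = {(u, w). u \<in> simple_verts G M \<and> w \<in> pverts G \<and> in_nbrs G w = {u}}"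

lemma (in pair_fin_digraph) private_path_system:
  obtains F where "F \<subseteq> private_arcs G M" "single_valued F" "acyclic F"
    "card (simple_verts G M - Domain F) \<le> card (M_bar G M) + card (S2 G M)"
proof -
  let ?A = "private_arcs G M"
  \<comment> \<open>A safe head lies on no cycle of private arcs.\<close>
  let ?safe = "\<lambda>u w. (u, w) \<in> ?A \<and> (w, w) \<notin> ?A\<^sup>+"
  define f where "f u = (if \<exists>w. ?safe u w then SOME w. ?safe u w else SOME w. (u, w) \<in> ?A)" for u
  \<comment> \<open>\<open>r\<close> marks one vertex on each cycle of \<open>S2\<close>;
    \<open>F\<close> omits the arc chosen there.\<close>
  define r where "r c = (SOME x. x \<in> class_verts c)" for c :: "('a \<times> 'a) awalk set"
  define F where "F = {(u, f u) | u. u \<in> Domain ?A - r ` S2 G M}"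
  have f_arc: "(u, f u) \<in> ?A" if "u \<in> Domain ?A" for u
  proof (cases "\<exists>w. ?safe u w")
    case True
    then show ?thesis using someI_ex[OF True] by (simp add: f_def)
  next
    case False
    then show ?thesis using that unfolding f_def by (auto intro: someI)
  qed
  have f_safe: "(f u, f u) \<notin> ?A\<^sup>+" if "?safe u w" for u w
    using that someI_ex[of "?safe u"] by (auto simp: f_def)
  have FA: "F \<subseteq> ?A" using f_arc by (auto simp: F_def)
  have A_arcs: "?A \<subseteq> parcs G" by (auto simp: private_arcs_def in_nbrs_def)
  have "acyclic F"
  proof (rule ccontr)
    assume "\<not> acyclic F"
    then obtain p where cyc: "cycle p" and pF: "set p \<subseteq> F"
      using FA A_arcs by (metis cycle_if_not_acyclic subset_trans)
    have pA: "set p \<subseteq> ?A" using pF FA by blast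
    have op: "OP_CC G p" using cyc pA by (auto simp: OP_CC_def private_arcs_def)
    have simple: "simple_cycle G M p"
      using cyc pA by (auto simp: simple_cycle_def cycle_verts_def private_arcs_def)
    have pred_in: "x \<in> cycle_verts p" if "(x, w) \<in> ?A" "w \<in> cycle_verts p" for x w
      using OP_CC_arcs_into[OF op that(2), of x] that(1)
      by (force simp: private_arcs_def cycle_verts_def)
    have rtrancl_pred_in: "x \<in> cycle_verts p" if "(x, w) \<in> ?A\<^sup>*" "w \<in> cycle_verts p" for x w
      using that by (induction rule: converse_rtrancl_induct) (auto intro: pred_in)
    have on_cycle: "(y, y) \<in> F\<^sup>+" if "y \<in> cycle_verts p" for y
      using cycle_trancl[OF cyc that that] trancl_mono[OF _ pF] by blast
    have "\<not> cycle_P2 G p"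
    proof
      \<comment> \<open>The private arc from \<open>u\<close> to \<open>w\<close> competes with the
        arc of \<open>p\<close>. As \<open>f\<close> chose an unsafe head at \<open>u\<close>,
        \<open>w\<close> is unsafe too. A cycle of private arcs through \<open>w\<close> enters it
        from \<open>u\<close>, so \<open>w\<close> leads back to \<open>p\<close> and thus lies on
        \<open>p\<close>.\<close>
      assume "cycle_P2 G p"
      then obtain w u where w: "w \<in> pverts G" "w \<notin> cycle_verts p" "u \<in> cycle_verts p"
        "in_nbrs G w = {u}" by (auto simp: cycle_P2_def)
      then have uw: "(u, w) \<in> ?A" using simple by (auto simp: private_arcs_def simple_cycle_def)
      obtain y where y: "(u, y) \<in> set p" using w(3) by (auto simp: cycle_verts_def)
      then have "y = f u" using pF by (auto simp: F_def)
      moreover have "y \<in> cycle_verts p" using y cycle_heads[OF cyc] by force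
      ultimately have "(f u, f u) \<in> ?A\<^sup>+" using on_cycle trancl_mono[OF _ FA] by blast
      then have "(w, w) \<in> ?A\<^sup>+" using f_safe uw by blast
      then obtain x where x: "(w, x) \<in> ?A\<^sup>*" "(x, w) \<in> ?A" by (meson tranclD2)
      then have "x = u" using w(4) by (auto simp: private_arcs_def)
      then show False using rtrancl_pred_in[OF x(1)] w by simp
    qed
    then have c: "rotation `` {p} \<in> S2 G M"
      using op simple by (auto simp: S2_def intro: quotientI)
    have "cycle_verts p \<noteq> {}" using cyc by (auto simp: cycle_def cycle_verts_def)
    \<comment> \<open>As a member of \<open>S2\<close> the cycle contains a vertex marked by
      \<open>r\<close>, but no such vertex is a tail in \<open>F\<close>.\<close>
    then have "r (rotation `` {p}) \<in> cycle_verts p"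
      unfolding r_def class_verts_rotation by (simp add: some_in_eq)
    moreover have "cycle_verts p \<inter> r ` S2 G M = {}"
      using pF by (auto simp: F_def cycle_verts_def)
    ultimately show False using c by blast
  qed
  moreover have "card (simple_verts G M - Domain F) \<le> card (M_bar G M) + card (S2 G M)"
  proof -
    have sub: "simple_verts G M - Domain F \<subseteq> M_bar G M \<union> r ` S2 G M"
      by (auto simp: F_def M_bar_def vertex_P1_def private_arcs_def)
    have "finite (M_bar G M)"
      using pair_finite_verts by (rule rev_finite_subset) (auto simp: M_bar_def simple_verts_def)
    then have "card (simple_verts G M - Domain F) \<le> card (M_bar G M \<union> r ` S2 G M)"
      using sub finite_S2 by (intro card_mono) auto
    also have "\<dots> \<le> card (M_bar G M) + card (r ` S2 G M)" by (rule card_Un_le)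
    also have "\<dots> \<le> card (M_bar G M) + card (S2 G M)" using finite_S2 by (simp add: card_image_le)
    finally show ?thesis .
  qed
  moreover have "single_valued F" by (auto simp: F_def single_valued_def)
  ultimately show thesis using that FA by blast
qed

section \<open>Construction of a control set\<close>

lemma controlled_SOG_exists:
  fixes G :: "'a pair_pre_digraph"
  assumes G: "pair_fin_digraph G" and marked: "pverts G \<inter> M \<noteq> {}"
  obtains L H where "L \<subseteq> pverts G" "controlled G L H" "SOG H M"
    "card L \<le> card (M_bar G M) + card (S2 G M)"
proof -
  interpret G: pair_fin_digraph G by fact
  let ?V = "pverts G" and ?S = "simple_verts G M"
  obtain F where F: "F \<subseteq> private_arcs G M" "single_valued F" "acyclic F"
    "card (?S - Domain F) \<le> card (M_bar G M) + card (S2 G M)"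
    by (rule G.private_path_system)
  have F_nbrs: "in_nbrs G w = {u}" if "(u, w) \<in> F" for u w
    using that F(1) by (auto simp: private_arcs_def)
  \<comment> \<open>The marked vertex makes the inclusion strict, which is what leaves room to avoid
    closing a cycle.\<close>
  have "?S \<subset> ?V" using marked by (auto simp: simple_verts_def)
  moreover have "F \<subseteq> ?S \<times> ?V" using F(1) by (auto simp: private_arcs_def)
  moreover have "single_valued (F\<inverse>)" by (auto simp: single_valued_def dest!: F_nbrs)
  ultimately obtain K where K: "F \<subseteq> K" "K \<subseteq> ?S \<times> ?V" "Domain K = ?S"
    "single_valued K" "single_valued (K\<inverse>)" "acyclic K"
    using extend_path_system[of ?V ?S F] G.pair_finite_verts F by metis
  \<comment> \<open>Exactly the heads of new arcs are controlled; each keeps its arc of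
    \<open>K\<close> as the only incoming one.\<close>
  define L where "L = Range (K - F)"
  define H where "H = \<lparr>pverts = ?V, parcs = {(u, w) \<in> parcs G. w \<notin> L} \<union> {(u, w) \<in> K. w \<in> L}\<rparr>"
  have finK: "finite K"
    using K(2) by (rule finite_subset) (simp add: simple_verts_def G.pair_finite_verts)
  have SV: "?S \<subseteq> ?V" by (auto simp: simple_verts_def)
  interpret H: pair_fin_digraph H
  proof
    show "finite (parcs H)"
      unfolding H_def using finK G.pair_finite_arcs by (auto intro: finite_subset[of _ "parcs G"] finite_subset[of _ K])
  qed (use K(2) SV G.pair_finite_verts in \<open>auto simp: H_def intro: G.wellformed'\<close>)
  have "controlled G L H"
    using H.pair_fin_digraph_axioms by (auto simp: controlled_def H_def in_nbrs_def)
  moreover have "SOG H M"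
  proof (rule SOG_if_acyclic)
    show "Domain K = simple_verts H M" using K by (simp add: H_def simple_verts_def)
    fix u w assume uw: "(u, w) \<in> K"
    have "in_nbrs H w = {u}"
    proof (cases "w \<in> L")
      case True
      then show ?thesis using uw K(5) by (auto simp: in_nbrs_def H_def single_valued_def)
    next
      case False
      then have "(u, w) \<in> F" using uw by (auto simp: L_def)
      then show ?thesis using False F_nbrs by (auto simp: in_nbrs_def H_def)
    qed
    then show "w \<in> pverts H \<and> in_nbrs H w = {u}" using uw K(2) by (auto simp: H_def)
  qed (use K H.pair_fin_digraph_axioms in auto)
  moreover have "L \<subseteq> ?V" using K(2) by (auto simp: L_def)
  moreover have "card L \<le> card (?S - Domain F)"
  proof -
    \<comment> \<open>Since \<open>K\<close> is single-valued and extends \<open>F\<close>, new arcs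
      have distinct tails, all outside \<open>Domain F\<close>.\<close>
    have "card L \<le> card (K - F)"
      using finK by (simp add: L_def Range_snd card_image_le)
    also have "\<dots> = card (fst ` (K - F))"
      using K(4) by (intro card_image[symmetric]) (auto simp: inj_on_def single_valued_def)
    also have "\<dots> \<le> card (?S - Domain F)"
    proof (rule card_mono)
      show "finite (?S - Domain F)" using G.pair_finite_verts SV by (auto intro: finite_subset)
      show "fst ` (K - F) \<subseteq> ?S - Domain F"
      proof
        fix u assume "u \<in> fst ` (K - F)"
        then obtain w where w: "(u, w) \<in> K" "(u, w) \<notin> F" by auto
        have "(u, x) \<notin> F" for x
          using w K(1) single_valuedD[OF K(4) w(1), of x] by blast
        then show "u \<in> ?S - Domain F" using w(1) K(3) by auto
      qed
    qed
    finally show ?thesis .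
  qed
  ultimately show thesis using that F(4) by (metis le_trans)
qed

theorem theorem6:
  fixes G :: "'a pair_pre_digraph" and v :: "nat \<Rightarrow> 'a" and n h :: nat
  assumes "marked_digraph G v n h"
    and "h > 0"
  shows "N_star G (marked v h) = card (M_bar G (marked v h)) + card (S2 G (marked v h))"
proof -
  interpret marked_digraph G v n h by fact
  let ?M = "marked v h"
  let ?k = "card (M_bar G ?M) + card (S2 G ?M)"
  let ?P = "\<lambda>k. \<exists>L\<subseteq>pverts G. card L = k \<and> (\<exists>H. controlled G L H \<and> SOG H ?M)"
  have "1 \<in> {1..n}" using \<open>h > 0\<close> h_le_n by simp
  then have "v 1 \<in> pverts G" using enum by (auto simp: bij_betw_def)
  moreover have "v 1 \<in> ?M" using \<open>h > 0\<close> by (auto simp: marked_def)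
  ultimately have "pverts G \<inter> ?M \<noteq> {}" by blast
  then obtain L H where L: "L \<subseteq> pverts G" "controlled G L H" "SOG H ?M" "card L \<le> ?k"
    using controlled_SOG_exists[OF pair_fin_digraph_axioms] by metis
  then have P: "?P (card L)" by blast
  have "N_star G ?M \<le> ?k"
    unfolding N_star_def using Least_le[of ?P, OF P] L(4) by linarith
  \<comment> \<open>Some control set exists, so the minimum is attained and the lower bound applies
    to an optimal set.\<close>
  moreover have "?P (N_star G ?M)" unfolding N_star_def using LeastI[of ?P, OF P] .
  then have "?k \<le> N_star G ?M" using card_le_controlled[OF pair_fin_digraph_axioms] by metis
  ultimately show ?thesis by simp
qed

end
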